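(* For every $n\in\mathbb{N}_0$, the polynomials ${}_{T}B_{n}^{(c,v)}(x,y,z;\lambda)$ and ${}_{T}B_{n}^{(s,v)}(x,y,z;\lambda)$ satisfy the differential equations $$\Bigl[xD_x+\frac{\mathcal{U}'(y,D_x)}{\mathcal{U}(y,D_x)}D_x+v\,\frac{\lambda e^{D_x}(1-D_x)-1}{\lambda e^{D_x}-1}-z\tan(zD_x)D_x-n\Bigr]{}_{T}B_{n}^{(c,v)}(x,y,z;\lambda)=0$$ and $$\Bigl[xD_x+\frac{\mathcal{U}'(y,D_x)}{\mathcal{U}(y,D_x)}D_x+v\,\frac{\lambda e^{D_x}(1-D_x)-1}{\lambda e^{D_x}-1}+z\cot(zD_x)D_x-n\Bigr]{}_{T}B_{n}^{(s,v)}(x,y,z;\lambda)=0.$$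
   Context: $\mathbb{N}_0=\{0,1,2,\dots\}$; $x,y,z$ are variables (taking complex values) and $\lambda\in\mathbb{C}\setminus\{0\}$. Let $\mathcal{U}(y,t)=\sum_{n\ge0}\mathcal{U}_n(y)\frac{t^n}{n!}$ be a power series in $t$ with coefficients depending on $y$ and $\mathcal{U}_0(y)\neq0$; the 2-variable general polynomials $T_n(x,y)$ are defined by $e^{xt}\mathcal{U}(y,t)=\sum_{n\ge0}T_n(x,y)\frac{t^n}{n!}$, with the normalization $T_0(x,y)=1$. The order $v$ is such that $\bigl(\frac{t}{\lambda e^t-1}\bigr)^v$ is a power series in $t$ ($v\in\mathbb{N}_0$ in general; $v\in\mathbb{C}$ allowed when $\lambda=1$, with the branch $1^v=1$ at $t=0$). The parametric kinds of generalized Apostol--Bernoulli polynomials are defined, as power series in $t$, by $$\Bigl(\frac{t}{\lambda e^t-1}\Bigr)^v e^{xt}\,\mathcal{U}(y,t)\cos(zt)=\sum_{n=0}^\infty {}_{T}B_{n}^{(c,v)}(x,y,z;\lambda)\frac{t^n}{n!},$$ $$\Bigl(\frac{t}{\lambda e^t-1}\Bigr)^v e^{xt}\,\mathcal{U}(y,t)\sin(zt)=\sum_{n=0}^\infty {}_{T}B_{n}^{(s,v)}(x,y,z;\lambda)\frac{t^n}{n!}.$$ They are polynomials in $x$. Here $D_x=\partial/\partial x$, $\mathcal{U}'(y,t)=\partial\mathcal{U}(y,t)/\partial t$, and for a power series $f(s)=\sum_{k\ge0}c_ks^k$ (coefficients independent of $x$), $f(D_x)=\sum_{k\ge0}c_kD_x^k$,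 a finite sum on any polynomial in $x$. The power series used are the expansions at $s=0$ of $\frac{\mathcal{U}'(y,s)}{\mathcal{U}(y,s)}s$, $v\frac{\lambda e^s(1-s)-1}{\lambda e^s-1}$, $z\tan(zs)\,s$ and $z\cot(zs)\,s=1-\frac{z^2s^2}{3}-\cdots$ (read as $1$ when $z=0$). *)

theory Defs
  imports "HOL-Analysis.Analysis"
begin

text \<open>
  All generating functions are formal power series in \<open>t\<close> over the complex numbers, with the
  variables \<open>x\<close>, \<open>y\<close>, \<open>z\<close> and the parameter \<open>\<lambda>\<close> (written \<open>lam\<close>) instantiated to complex
  numbers.  The family of coefficients is \<open>U :: nat \<Rightarrow> complex \<Rightarrow> complex\<close>, where \<open>U n y\<close> stands
  for \<open>\<U>\<^sub>n(y)\<close>.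
\<close>

definition U_fps :: "(nat \<Rightarrow> complex \<Rightarrow> complex) \<Rightarrow> complex \<Rightarrow> complex fps" where
  "U_fps U y = Abs_fps (\<lambda>n. U n y / fact n)"

definition gen_poly :: "(nat \<Rightarrow> complex \<Rightarrow> complex) \<Rightarrow> nat \<Rightarrow> complex \<Rightarrow> complex \<Rightarrow> complex" where
  "gen_poly U n x y = fact n * fps_nth (fps_exp x * U_fps U y) n"

text \<open>
  The quotient \<open>t / (\<lambda> e\<^sup>t - 1)\<close>.  Division of formal power series over a field cancels common powers
  of the variable, so for \<open>\<lambda> = 1\<close> this is the usual series \<open>1 - t/2 + \<dots>\<close>.
\<close>

definition apostol_base :: "complex \<Rightarrow> complex fps" where
  "apostol_base lam = fps_X / (fps_const lam * fps_exp 1 - 1)"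

text \<open>
  Its power of order \<open>v\<close>.  For \<open>v\<close> a natural number this is the ordinary power.  Other orders only
  occur for \<open>\<lambda> = 1\<close>, where the base has constant term 1 and the power on the branch with value 1 at
  \<open>t = 0\<close> is the binomial series \<open>(1 + w)\<^sup>v\<close> at \<open>w\<close> = base - 1.
\<close>

definition apostol_pow :: "complex \<Rightarrow> complex \<Rightarrow> complex fps" where
  "apostol_pow lam v =
     (if v \<in> \<nat> then apostol_base lam ^ (THE m. v = of_nat m)
      else fps_compose (fps_binomial v) (apostol_base lam - 1))"

definition TB_cos :: "(nat \<Rightarrow> complex \<Rightarrow> complex) \<Rightarrow> nat \<Rightarrow> complex \<Rightarrow>
    complex \<Rightarrow> complex \<Rightarrow> complex \<Rightarrow> complex \<Rightarrow> complex" where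
  "TB_cos U n v x y z lam =
     fact n * fps_nth (apostol_pow lam v * fps_exp x * U_fps U y * fps_cos z) n"

definition TB_sin :: "(nat \<Rightarrow> complex \<Rightarrow> complex) \<Rightarrow> nat \<Rightarrow> complex \<Rightarrow>
    complex \<Rightarrow> complex \<Rightarrow> complex \<Rightarrow> complex \<Rightarrow> complex" where
  "TB_sin U n v x y z lam =
     fact n * fps_nth (apostol_pow lam v * fps_exp x * U_fps U y * fps_sin z) n"

text \<open>
  The operator \<open>f(D)\<close> with \<open>D = d/dx\<close>.  On polynomial functions the series has only finitely many
  nonzero terms; see \<open>fps_diff_op_poly\<close> and \<open>TB_cos_poly\<close>, \<open>TB_sin_poly\<close> below.
\<close>

definition fps_diff_op :: "complex fps \<Rightarrow> (complex \<Rightarrow> complex) \<Rightarrow> complex \<Rightarrow> complex" where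
  "fps_diff_op f g x = (\<Sum>k. fps_nth f k * (deriv ^^ k) g x)"

definition U_symbol :: "(nat \<Rightarrow> complex \<Rightarrow> complex) \<Rightarrow> complex \<Rightarrow> complex fps" where
  "U_symbol U y = fps_deriv (U_fps U y) / U_fps U y * fps_X"

definition apostol_symbol :: "complex \<Rightarrow> complex \<Rightarrow> complex fps" where
  "apostol_symbol lam v = fps_const v *
     ((fps_const lam * fps_exp 1 * (1 - fps_X) - 1) / (fps_const lam * fps_exp 1 - 1))"

definition tan_symbol :: "complex \<Rightarrow> complex fps" where
  "tan_symbol z = fps_const z * fps_tan z * fps_X"

text \<open>
  \<open>cot(zs)\<close> itself has a pole at \<open>s = 0\<close>, so the factor \<open>s\<close> is put into the numerator before dividing.
\<close>

definition cot_symbol :: "complex \<Rightarrow> complex fps" where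
  "cot_symbol z = (if z = 0 then 1 else (fps_const z * fps_cos z * fps_X) / fps_sin z)"


subsection \<open>Consistency of the definitions\<close>

lemma apostol_base_1_nth_0: "fps_nth (apostol_base 1) 0 = 1"
proof -
  have s: "subdegree (fps_exp 1 - 1 :: complex fps) = 1"
    by (rule subdegreeI) (simp_all add: fps_exp_def)
  then show ?thesis
    using fps_divide_nth_base[of "fps_exp 1 - 1 :: complex fps" fps_X]
    by (simp add: apostol_base_def del: subdegree_minus_commute)
qed

lemma apostol_pow_of_nat: "apostol_pow lam (of_nat m) = apostol_base lam ^ m"
  by (simp add: apostol_pow_def)

lemma apostol_pow_1_eq_binomial:
  "apostol_pow 1 v = fps_compose (fps_binomial v) (apostol_base 1 - 1)"
proof (cases "v \<in> \<nat>")
  case True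
  then obtain m where m: "v = of_nat m" by (auto elim: Nats_cases)
  have "fps_nth (apostol_base 1 - 1) 0 = 0" by (simp add: apostol_base_1_nth_0)
  then show ?thesis
    by (simp add: m apostol_pow_of_nat fps_binomial_of_nat fps_compose_add_distrib
          flip: fps_compose_power)
qed (simp add: apostol_pow_def)

lemma fps_exp_mult_nth_poly: "\<exists>p. \<forall>x::complex. fact n * fps_nth (a * fps_exp x * b * c) n = poly p x"
proof -
  define d where "d = a * b * c"
  define p where "p = (\<Sum>i=0..n. monom (fact n * fps_nth d (n - i) / fact i) i)"
  have "fact n * fps_nth (a * fps_exp x * b * c) n = poly p x" for x :: complex
  proof -
    have eq: "a * fps_exp x * b * c = fps_exp x * d" by (simp add: d_def ac_simps)
    show ?thesis
      unfolding eq fps_mult_nth by (simp add: p_def poly_sum poly_monom sum_distrib_left mult_ac)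
  qed
  then show ?thesis by blast
qed

lemma TB_cos_poly: "\<exists>p. (\<lambda>x. TB_cos U n v x y z lam) = poly p"
  using fps_exp_mult_nth_poly unfolding TB_cos_def fun_eq_iff by blast

lemma TB_sin_poly: "\<exists>p. (\<lambda>x. TB_sin U n v x y z lam) = poly p"
  using fps_exp_mult_nth_poly unfolding TB_sin_def fun_eq_iff by blast

lemma higher_deriv_poly: "(deriv ^^ k) (poly p) = poly ((pderiv ^^ k) (p :: complex poly))"
  by (induction k) (auto intro!: ext DERIV_imp_deriv)

lemma fps_diff_op_poly:
  "fps_diff_op f (poly p) x = (\<Sum>k\<le>degree p. fps_nth f k * poly ((pderiv ^^ k) p) x)"
  unfolding fps_diff_op_def higher_deriv_poly
proof (rule suminf_finite)
  fix k assume "k \<notin> {..degree p}"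
  then have "(pderiv ^^ k) p = 0"
    by (intro poly_eqI) (simp add: coeff_higher_pderiv coeff_eq_0)
  then show "fps_nth f k * poly ((pderiv ^^ k) p) x = 0" by simp
qed simp

lemma cot_symbol_mult_sin:
  "cot_symbol z * fps_sin z = fps_const z * fps_cos z * fps_X"
proof (cases "z = 0")
  case False
  have s: "subdegree (fps_sin z) = 1"
    by (rule subdegreeI) (use False in \<open>simp_all add: fps_sin_def\<close>)
  then have nz: "fps_sin z \<noteq> 0" by auto
  have "fps_sin z dvd fps_X"
    using s nz by (simp add: fps_dvd_iff)
  then have "fps_sin z dvd fps_const z * fps_cos z * fps_X" by (rule dvd_mult)
  then show ?thesis using False by (simp add: cot_symbol_def)
qed (simp add: cot_symbol_def)

end

theory Submission
  imports Defs
begin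

text \<open>
  On \<open>B\<^sub>n(x) = n! [t\<^sup>n] (e\<^sup>x\<^sup>t d(t))\<close> the operator \<open>D\<^sub>x\<close> acts as multiplication of the generating
  function by \<open>t\<close>, hence \<open>f(D\<^sub>x)\<close> as multiplication by \<open>f(t)\<close>.  The equations therefore say that
  \<open>t \<partial>\<^sub>t G = a G\<close> for the generating function \<open>G\<close>, where \<open>a\<close> is the sum of the symbols; this is
  the product rule for logarithmic derivatives, each symbol being \<open>t\<close> times the logarithmic
  derivative of one factor of \<open>G\<close>.
\<close>

text \<open>Termwise in the Cauchy product, the coefficient \<open>x ^ i / fact i\<close> of
  \<open>fps_exp x\<close> becomes that of index \<open>i - 1\<close>, which is a shift by
  \<open>fps_X\<close>.\<close>

lemma deriv_nth_fps_exp_mult: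
  fixes d :: "complex fps"
  shows "deriv (\<lambda>x. c * fps_nth (fps_exp x * d) n) = (\<lambda>x. c * fps_nth (fps_exp x * (fps_X * d)) n)"
proof
  fix x :: complex
  have nth: "((\<lambda>x. fps_nth (fps_exp x) i * fps_nth d (n - i)) has_field_derivative
      fps_nth (fps_X * fps_exp x) i * fps_nth d (n - i)) (at x)" for i
  proof (cases i)
    case (Suc j)
    have "((\<lambda>x. x ^ Suc j) has_field_derivative of_nat (Suc j) * x ^ j) (at x)"
      using DERIV_power_Suc[OF DERIV_ident, of j x UNIV] by simp
    then have "((\<lambda>x. x ^ Suc j / fact (Suc j)) has_field_derivative
        of_nat (Suc j) * x ^ j / fact (Suc j)) (at x)"
      by (rule DERIV_cdivide)
    also have "of_nat (Suc j) * x ^ j / fact (Suc j) = x ^ j / fact j"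
      by (simp del: of_nat_Suc)
    finally have "((\<lambda>x. x ^ Suc j / fact (Suc j)) has_field_derivative x ^ j / fact j) (at x)" .
    from DERIV_cmult_right[OF this, of "fps_nth d (n - i)"] show ?thesis
      using Suc by (simp add: distrib_right)
  qed simp
  have "((\<lambda>x. c * fps_nth (fps_exp x * d) n) has_field_derivative
      c * fps_nth (fps_X * fps_exp x * d) n) (at x)"
    unfolding fps_mult_nth[of _ d] by (intro DERIV_cmult DERIV_sum nth)
  then show "deriv (\<lambda>x. c * fps_nth (fps_exp x * d) n) x = c * fps_nth (fps_exp x * (fps_X * d)) n"
    by (simp add: DERIV_imp_deriv mult_ac)
qed

lemma higher_deriv_nth_fps_exp_mult:
  fixes d :: "complex fps"
  shows "(deriv ^^ k) (\<lambda>x. c * fps_nth (fps_exp x * d) n)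
    = (\<lambda>x. c * fps_nth (fps_X ^ k * (fps_exp x * d)) n)"
proof (induction k)
  case (Suc k)
  have "(\<lambda>x. c * fps_nth (fps_X ^ k * (fps_exp x * d)) n)
      = (\<lambda>x. c * fps_nth (fps_exp x * (fps_X ^ k * d)) n)"
    by (simp add: mult.left_commute)
  then show ?case
    using Suc by (simp only: funpow.simps o_apply deriv_nth_fps_exp_mult) (simp only: power_Suc mult_ac)
qed simp

text \<open>The \<open>k\<close>-th derivative shifts the coefficients by \<open>k\<close>, so the
  terms with \<open>k > n\<close> vanish and the rest form the Cauchy product with
  \<open>f\<close>.\<close>

lemma fps_diff_op_nth_fps_exp_mult:
  "fps_diff_op f (\<lambda>x. c * fps_nth (fps_exp x * d) n) x = c * fps_nth (f * (fps_exp x * d)) n"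
proof -
  have "fps_diff_op f (\<lambda>x. c * fps_nth (fps_exp x * d) n) x
      = (\<Sum>k. fps_nth f k * (c * fps_nth (fps_X ^ k * (fps_exp x * d)) n))"
    by (simp add: fps_diff_op_def higher_deriv_nth_fps_exp_mult)
  also have "\<dots> = (\<Sum>k\<le>n. fps_nth f k * (c * fps_nth (fps_X ^ k * (fps_exp x * d)) n))"
    by (rule suminf_finite) (auto simp: fps_X_power_mult_nth)
  also have "\<dots> = c * fps_nth (f * (fps_exp x * d)) n"
    unfolding fps_mult_nth[of f] sum_distrib_left atLeast0AtMost
    by (intro sum.cong) (auto simp: fps_X_power_mult_nth)
  finally show ?thesis .
qed

text \<open>Logarithmic derivatives add. Stating this without quotients lets it apply to
  \<open>fps_sin z\<close>, which is not a unit.\<close>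

lemma fps_X_deriv_mult:
  fixes f g :: "'a::comm_ring_1 fps"
  assumes "fps_X * fps_deriv f = a * f" and "fps_X * fps_deriv g = b * g"
  shows "fps_X * fps_deriv (f * g) = (a + b) * (f * g)"
proof -
  have "fps_X * fps_deriv (f * g) = (fps_X * fps_deriv f) * g + f * (fps_X * fps_deriv g)"
    by (simp add: algebra_simps)
  then show ?thesis
    by (simp add: assms algebra_simps)
qed

lemma fps_X_deriv_exp:
  fixes x :: complex
  shows "fps_X * fps_deriv (fps_exp x) = (fps_const x * fps_X) * fps_exp x"
  by (simp add: mult_ac)

lemma fps_X_deriv_U_fps:
  assumes "U 0 y \<noteq> 0"
  shows "fps_X * fps_deriv (U_fps U y) = U_symbol U y * U_fps U y"
proof -
  have "fps_nth (U_fps U y) 0 \<noteq> 0"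
    using assms by (simp add: U_fps_def)
  then have "U_fps U y dvd fps_deriv (U_fps U y)"
    by (simp add: unit_imp_dvd)
  then show ?thesis
    by (simp add: U_symbol_def mult_ac)
qed

lemma fps_X_deriv_cos: "fps_X * fps_deriv (fps_cos z) = - tan_symbol z * fps_cos z"
proof -
  have "fps_cos z dvd fps_sin z"
    by (simp add: unit_imp_dvd)
  then have "fps_tan z * fps_cos z = fps_sin z"
    by (simp add: fps_tan_def)
  then show ?thesis
    by (simp add: tan_symbol_def fps_cos_deriv mult_ac flip: fps_const_neg)
qed

lemma fps_X_deriv_sin: "fps_X * fps_deriv (fps_sin z) = cot_symbol z * fps_sin z"
  by (simp add: cot_symbol_mult_sin fps_sin_deriv mult_ac)

text \<open>The divisor has constant term \<open>lam - 1\<close>: it is a unit for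
  \<open>lam \<noteq> 1\<close> and has subdegree 1 for \<open>lam = 1\<close>. This makes the
  quotients in \<open>apostol_base\<close> and \<open>apostol_symbol\<close> exact.\<close>

lemma apostol_denominator_dvd:
  fixes lam :: complex
  assumes "lam \<noteq> 0" and "lam = 1 \<longrightarrow> fps_nth f 0 = 0"
  shows "fps_const lam * fps_exp 1 - 1 dvd f"
proof (cases "lam = 1")
  case True
  have "subdegree (fps_exp 1 - 1 :: complex fps) = 1"
    by (rule subdegreeI) simp_all
  moreover from this have "fps_exp 1 - 1 \<noteq> (0 :: complex fps)"
    by (metis subdegree_0 zero_neq_one)
  \<comment> \<open>The zero series is separate because its subdegree is 0 by convention.\<close>
  moreover have "f = 0 \<or> 1 \<le> subdegree f"
    using assms True by (metis One_nat_def Suc_leI gr0I nth_subdegree_nonzero)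
  ultimately have "fps_exp 1 - 1 dvd f"
    by (metis dvd_0_right fps_dvd_iff)
  then show ?thesis
    using True by simp
next
  case False
  then have "fps_nth (fps_const lam * fps_exp 1 - 1) 0 \<noteq> 0"
    by simp
  then show ?thesis
    by (simp add: unit_imp_dvd)
qed

lemma fps_X_deriv_apostol_pow:
  assumes lam: "lam \<noteq> 0" and v: "v \<in> \<nat> \<or> lam = 1"
  shows "fps_X * fps_deriv (apostol_pow lam v) = apostol_symbol lam v * apostol_pow lam v"
proof -
  define b where "b = apostol_base lam"
  define q where "q = fps_const lam * fps_exp 1 - 1"
  define a where "a = (fps_const lam * fps_exp 1 * (1 - fps_X) - 1) / q"
  have bq: "b * q = fps_X"
    using apostol_denominator_dvd[OF lam, of fps_X] by (simp add: b_def q_def apostol_base_def)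
  have "a * q = fps_const lam * fps_exp 1 * (1 - fps_X) - 1"
    using apostol_denominator_dvd[OF lam, of "fps_const lam * fps_exp 1 * (1 - fps_X) - 1"]
    by (simp add: a_def q_def)
  \<comment> \<open>Here \<open>fps_deriv q\<close> is
    \<open>fps_const lam * fps_exp 1\<close>.\<close>
  then have aq: "a * q = q - fps_X * fps_deriv q"
    by (simp add: q_def algebra_simps)
  have nz: "b \<noteq> 0" "q \<noteq> 0"
    using bq by auto
  have "fps_deriv b * q + b * fps_deriv q = 1"
    using arg_cong[OF bq, of fps_deriv] by (simp add: add_ac mult_ac)
  then have "(fps_X * fps_deriv b) * q = fps_X * (1 - b * fps_deriv q)"
    by (simp add: algebra_simps flip: eq_diff_eq)
  also have "\<dots> = b * q - fps_X * (b * fps_deriv q)"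
    by (simp add: bq algebra_simps)
  also have "\<dots> = b * (a * q)"
    by (simp add: aq algebra_simps)
  finally have base: "fps_X * fps_deriv b = a * b"
    using nz by (simp add: mult_ac)
  \<comment> \<open>The power rule multiplied by \<open>b\<close>: no exponent \<open>v - 1\<close>
    appears, so one formula covers natural powers and the binomial series.\<close>
  have pow: "b * fps_deriv (apostol_pow lam v) = fps_const v * apostol_pow lam v * fps_deriv b"
  proof (cases "v \<in> \<nat>")
    case True
    then obtain m where m: "v = of_nat m"
      by (auto elim: Nats_cases)
    show ?thesis
      unfolding m apostol_pow_of_nat b_def[symmetric] fps_deriv_power fps_of_nat
      \<comment> \<open>The case split separates \<open>m = 0\<close>, where the exponent
        \<open>m - 1\<close> is truncated.\<close>
      by (cases m) (simp_all add: mult_ac)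
  next
    case False
    with v have one: "lam = 1"
      by simp
    then have b0: "fps_nth (b - 1) 0 = 0"
      by (simp add: b_def apostol_base_1_nth_0)
    \<comment> \<open>The differential equation of the binomial series; substituting
      \<open>b - 1\<close> turns \<open>1 + fps_X\<close> into \<open>b\<close>.\<close>
    have "(1 + fps_X) * fps_deriv (fps_binomial v) = fps_const v * fps_binomial v"
      by (simp add: fps_binomial_deriv fps_divide_unit inverse_mult_eq_1' mult_ac)
    then have "((1 + fps_X) * fps_deriv (fps_binomial v)) oo (b - 1)
        = (fps_const v * fps_binomial v) oo (b - 1)"
      by simp
    then have "b * (fps_deriv (fps_binomial v) oo (b - 1)) = fps_const v * apostol_pow lam v"
      using b0 by (simp add: fps_compose_mult_distrib fps_compose_add_distrib one
        apostol_pow_1_eq_binomial b_def)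
    then show ?thesis
      using b0 by (simp add: one apostol_pow_1_eq_binomial b_def fps_compose_deriv flip: mult.assoc)
  qed
  have "b * (fps_X * fps_deriv (apostol_pow lam v))
      = fps_const v * apostol_pow lam v * (fps_X * fps_deriv b)"
    using pow by (metis mult.left_commute)
  also have "\<dots> = b * (fps_const v * a * apostol_pow lam v)"
    by (simp add: base mult_ac)
  finally show ?thesis
    using nz by (simp add: apostol_symbol_def a_def q_def)
qed

text \<open>Coefficient \<open>n\<close> of \<open>fps_X * fps_deriv G\<close> is \<open>n\<close>
  times that of \<open>G\<close>. In the product rule the factor \<open>fps_exp x\<close>
  contributes \<open>x * fps_X\<close>, which is the term with \<open>deriv\<close>.\<close>

lemma nth_fps_exp_mult_ode:
  fixes a d :: "complex fps"
  assumes "fps_X * fps_deriv d = a * d"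
  shows "x * deriv (\<lambda>x. c * fps_nth (fps_exp x * d) n) x
      + c * fps_nth (a * (fps_exp x * d)) n - of_nat n * (c * fps_nth (fps_exp x * d) n) = 0"
proof -
  have "of_nat n * fps_nth (fps_exp x * d) n = fps_nth (fps_X * fps_deriv (fps_exp x * d)) n"
    by (cases n) (simp_all del: fps_deriv_mult)
  also have "\<dots> = fps_nth (fps_const x * (fps_exp x * (fps_X * d)) + a * (fps_exp x * d)) n"
    unfolding fps_X_deriv_mult[OF fps_X_deriv_exp assms] by (simp add: algebra_simps)
  finally have "of_nat n * fps_nth (fps_exp x * d) n
      = x * fps_nth (fps_exp x * (fps_X * d)) n + fps_nth (a * (fps_exp x * d)) n"
    by simp
  then show ?thesis
    unfolding deriv_nth_fps_exp_mult mult.left_commute[of "of_nat n" c]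
    by (simp only: distrib_left mult.left_commute[of x c]) simp
qed

theorem theorem2p3:
  fixes U :: "nat \<Rightarrow> complex \<Rightarrow> complex"
    and v x y z lam :: complex
    and n :: nat
  assumes "lam \<noteq> 0"
    and "v \<in> \<nat> \<or> lam = 1"
    and "\<And>y. U 0 y \<noteq> 0"
    and "\<And>x y. gen_poly U 0 x y = 1"
  shows "(let B = (\<lambda>x. TB_cos U n v x y z lam) in
           x * deriv B x + fps_diff_op (U_symbol U y) B x
             + fps_diff_op (apostol_symbol lam v) B x
             - fps_diff_op (tan_symbol z) B x - of_nat n * B x = 0) \<and>
         (let B = (\<lambda>x. TB_sin U n v x y z lam) in
           x * deriv B x + fps_diff_op (U_symbol U y) B x
             + fps_diff_op (apostol_symbol lam v) B x
             + fps_diff_op (cot_symbol z) B x - of_nat n * B x = 0)"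
proof -
  \<comment> \<open>This factor is common to both generating functions; only the trigonometric
    factor differs.\<close>
  have core: "fps_X * fps_deriv (U_fps U y * apostol_pow lam v)
      = (U_symbol U y + apostol_symbol lam v) * (U_fps U y * apostol_pow lam v)"
    using assms by (intro fps_X_deriv_mult fps_X_deriv_apostol_pow fps_X_deriv_U_fps)
  have cos: "(\<lambda>x. TB_cos U n v x y z lam)
      = (\<lambda>x. fact n * fps_nth (fps_exp x * (U_fps U y * apostol_pow lam v * fps_cos z)) n)"
    by (simp add: TB_cos_def mult_ac)
  have sin: "(\<lambda>x. TB_sin U n v x y z lam)
      = (\<lambda>x. fact n * fps_nth (fps_exp x * (U_fps U y * apostol_pow lam v * fps_sin z)) n)"
    by (simp add: TB_sin_def mult_ac)
  show ?thesis
    unfolding Let_def cos sin fps_diff_op_nth_fps_exp_mult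
    using nth_fps_exp_mult_ode[OF fps_X_deriv_mult[OF core fps_X_deriv_cos[of z]], of x "fact n" n]
      nth_fps_exp_mult_ode[OF fps_X_deriv_mult[OF core fps_X_deriv_sin[of z]], of x "fact n" n]
    by (simp add: distrib_right left_diff_distrib distrib_left right_diff_distrib
        add_diff_eq flip: add.assoc)
qed

end
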